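(* Let $J=\{1,2,\dots,m\}$ and let $\{C_j\}_{j\in J}$ be a collection of closed convex subsets of a real Hilbert space $H$ with non-empty intersection. Given $x^0\in H$, set, for $t\in\mathbb{N}$, $$x^{t+1}=P_{C_j}(x^t),\qquad\text{where } j\in J \text{ is the unique index with } j\equiv t \pmod m.$$ Suppose that $\{C_j\}_{j\in J}$ has a bounded Hölder regular intersection. Then $x^t\to\bar x$ in norm for some $\bar x\in\bigcap_{j\in J}C_j$ at least with a sublinear rate $O(t^{-\rho})$ for some $\rho>0$. In particular, if the collection $\{C_j\}_{j\in J}$ has a bounded Hölder regular intersection with uniform exponent $\gamma\in(0,1]$, then there exist $M>0$ and $r\in[0,1)$ such that, for all $t\ge1$, $$\|x^t-\bar x\|\le\begin{cases}M\,t^{-\frac{\gamma}{2(1-\gamma)}},&\gamma\in(0,1),\\ M\,r^t,&\gamma=1.\end{cases}$$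
   Context: $\mathbb{N}=\{0,1,2,\dots\}$; $d(x,A)=\inf_{a\in A}\|x-a\|$; $P_A$ is the nearest point projection onto the closed convex set $A$. A collection $\{C_j\}_{j\in J}$ of closed convex subsets of $H$ with non-empty intersection has a bounded Hölder regular intersection if for each bounded set $K\subseteq H$ there exist $\gamma\in(0,1]$ and $\beta>0$ such that $d(x,\bigcap_{j\in J}C_j)\le\beta\left(\max_{j\in J}d(x,C_j)\right)^\gamma$ for all $x\in K$. If $\gamma$ can be chosen independently of $K$, this holds with uniform exponent $\gamma$. Convergence with rate $O(t^{-\rho})$ means $\|x^t-\bar x\|\le Mt^{-\rho}$ for all $t\ge1$ and some constant $M$. *)

theory Defs
  imports "HOL-Analysis.Analysis" "HOL-Number_Theory.Cong"
begin

(* The library's closest_point is restricted to heine_borel, i.e. to finite dimension. This version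
   is meant for a non-empty closed convex A, where the nearest point exists and is unique. *)
definition nearest_point :: "'a::{real_inner, complete_space} set \<Rightarrow> 'a \<Rightarrow> 'a" where
  "nearest_point A x = (THE p. p \<in> A \<and> (\<forall>y\<in>A. norm (x - p) \<le> norm (x - y)))"

(* Meant for finite non-empty J (Max is only meaningful there). Since g > 0, the convention
   0 powr g = 0 agrees with the usual power at 0. *)
definition hoelder_regular_on ::
    "'a::real_inner set \<Rightarrow> 'i set \<Rightarrow> ('i \<Rightarrow> 'a set) \<Rightarrow> real \<Rightarrow> bool" where
  "hoelder_regular_on K J C g \<longleftrightarrow>
     (\<exists>b>0. \<forall>x\<in>K. infdist x (\<Inter>j\<in>J. C j) \<le> b * (MAX j\<in>J. infdist x (C j)) powr g)"

definition bounded_hoelder_regular ::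
    "'i set \<Rightarrow> ('i \<Rightarrow> 'a::real_inner set) \<Rightarrow> bool" where
  "bounded_hoelder_regular J C \<longleftrightarrow>
     (\<forall>K. bounded K \<longrightarrow> (\<exists>g\<in>{0<..1}. hoelder_regular_on K J C g))"

definition bounded_hoelder_regular_uniform ::
    "'i set \<Rightarrow> ('i \<Rightarrow> 'a::real_inner set) \<Rightarrow> real \<Rightarrow> bool" where
  "bounded_hoelder_regular_uniform J C g \<longleftrightarrow>
     g \<in> {0<..1} \<and> (\<forall>K. bounded K \<longrightarrow> hoelder_regular_on K J C g)"

definition sublinear_rate :: "(nat \<Rightarrow> 'a::real_normed_vector) \<Rightarrow> 'a \<Rightarrow> real \<Rightarrow> bool" where
  "sublinear_rate x l \<rho> \<longleftrightarrow> (\<exists>M. \<forall>t\<ge>1. norm (x t - l) \<le> M * real t powr (- \<rho>))"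

end

theory Submission
  imports Defs
begin

text \<open>Let \<open>F\<close> be the intersection. The iterates are Fejer monotone with respect to \<open>F\<close>, and over one
  cycle of \<open>m\<close> steps the squared distance to \<open>F\<close> drops by at least the sum \<open>S\<close> of the squared step
  lengths. Every \<open>C j\<close> is visited during the cycle, so each distance to \<open>C j\<close> is at most
  \<open>sqrt (m * S)\<close>, and Hoelder regularity on the bounded orbit gives
  \<open>\<beta> (k + 1) \<le> \<beta> k - c * \<beta> k powr (1 / \<gamma>)\<close> for the squared distances \<open>\<beta> k\<close> to \<open>F\<close> at the
  times \<open>m * k\<close>. This forces \<open>\<beta> k\<close> to decay polynomially or, if \<open>\<gamma> = 1\<close>, geometrically, and Fejer
  monotonicity bounds the distance to the limit by twice the distance to \<open>F\<close>.\<close>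

section \<open>Projection onto a closed convex set of a Hilbert space\<close>

text \<open>Parallelogram law for \<open>a - y\<close> and \<open>a - z\<close>, whose sum is twice
  \<open>a - midpoint y z\<close>. It forces two near-minimisers of the distance to \<open>a\<close>
  to be close to each other.\<close>

lemma midpoint_norm_identity:
  fixes a y z :: "'a::real_inner"
  shows "(norm (y - z))\<^sup>2 =
    2 * (norm (a - y))\<^sup>2 + 2 * (norm (a - z))\<^sup>2 - 4 * (norm (a - midpoint y z))\<^sup>2"
proof -
  have "(norm (v - u))\<^sup>2 = 2 * (norm u)\<^sup>2 + 2 * (norm v)\<^sup>2 - (norm (u + v))\<^sup>2" for u v :: 'a
    by (simp add: power2_norm_eq_inner inner_diff_left inner_diff_right
        inner_add_left inner_add_right inner_commute)
  from this[of "a - z" "a - y"] have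
    "(norm (y - z))\<^sup>2 =
      2 * (norm (a - y))\<^sup>2 + 2 * (norm (a - z))\<^sup>2 - (norm ((a - y) + (a - z)))\<^sup>2"
    by (simp add: norm_minus_commute add.commute)
  moreover have "(a - y) + (a - z) = 2 *\<^sub>R (a - midpoint y z)"
    by (simp add: midpoint_def scaleR_diff_right scaleR_2)
  ultimately show ?thesis by (simp add: power_mult_distrib)
qed

text \<open>The points of \<open>A\<close> whose squared distance to \<open>a\<close> exceeds the
  infimum by at most 1/(n+1) form nested closed sets with diameters tending to 0. Completeness
  yields a common point, which attains the infimum.\<close>

lemma nearest_point_exists:
  fixes A :: "'a::{real_inner, complete_space} set"
  assumes "closed A" "convex A" "A \<noteq> {}"
  obtains p where "p \<in> A" "\<And>y. y \<in> A \<Longrightarrow> norm (a - p) \<le> norm (a - y)"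
proof -
  define d where "d = infdist a A"
  have d0: "d \<ge> 0" by (simp add: d_def infdist_nonneg)
  have dle: "d \<le> norm (a - y)" if "y \<in> A" for y
    using infdist_le[OF that, of a] by (simp add: d_def dist_norm)
  define S where "S n = A \<inter> {y. (norm (a - y))\<^sup>2 \<le> d\<^sup>2 + inverse (real (Suc n))}" for n
  have "\<exists>p. \<forall>n. p \<in> S n"
  proof (rule decreasing_closed_nest)
    show "closed (S n)" for n
      unfolding S_def by (intro closed_Int assms closed_Collect_le continuous_intros)
    show "S n \<noteq> {}" for n
    proof -
      have "sqrt (d\<^sup>2 + inverse (real (Suc n))) > d"
        by (rule real_less_rsqrt) simp
      then obtain y where y: "y \<in> A" "dist a y < sqrt (d\<^sup>2 + inverse (real (Suc n)))"
        unfolding d_def using assms(3) by (auto simp: infdist_notempty cINF_less_iff)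
      then have "(dist a y)\<^sup>2 \<le> (sqrt (d\<^sup>2 + inverse (real (Suc n))))\<^sup>2"
        by (intro power_mono) auto
      then show ?thesis using y(1) by (auto simp: S_def dist_norm)
    qed
    show "S n \<subseteq> S k" if "k \<le> n" for k n
    proof -
      have "inverse (real (Suc n)) \<le> inverse (real (Suc k))" using that by simp
      then have "d\<^sup>2 + inverse (real (Suc n)) \<le> d\<^sup>2 + inverse (real (Suc k))"
        by (rule add_left_mono)
      then show ?thesis unfolding S_def using order_trans by blast
    qed
    show "\<exists>n. \<forall>y\<in>S n. \<forall>z\<in>S n. dist y z < e" if "e > 0" for e
    proof -
      obtain n where n: "inverse (real (Suc n)) < e\<^sup>2 / 4"
        using reals_Archimedean[of "e\<^sup>2 / 4"] \<open>e > 0\<close> by auto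
      \<comment> \<open>Convexity keeps the midpoint in \<open>A\<close>, hence at distance at least
        \<open>d\<close>; the identity then leaves 4/(n+1) as a bound for the squared distance of
        \<open>y\<close> and \<open>z\<close>.\<close>
      have "dist y z < e" if "y \<in> S n" "z \<in> S n" for y z
      proof -
        have "midpoint y z \<in> A"
          using that assms(2) by (auto simp: S_def midpoint_def scaleR_add_right convexD)
        then have "d\<^sup>2 \<le> (norm (a - midpoint y z))\<^sup>2"
          using dle d0 by (intro power_mono) auto
        moreover have "(norm (a - y))\<^sup>2 \<le> d\<^sup>2 + inverse (real (Suc n))"
          "(norm (a - z))\<^sup>2 \<le> d\<^sup>2 + inverse (real (Suc n))"
          using that by (auto simp: S_def)
        ultimately have "(norm (y - z))\<^sup>2 < e\<^sup>2"
          using midpoint_norm_identity[of y z a] n by linarith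
        then show ?thesis
          using \<open>e > 0\<close> by (simp add: dist_norm power_less_imp_less_base)
      qed
      then show ?thesis by blast
    qed
  qed blast
  then obtain p where p: "p \<in> S n" for n by blast
  have "(norm (a - p))\<^sup>2 \<le> d\<^sup>2"
  proof (rule field_le_epsilon)
    fix e :: real assume "e > 0"
    then obtain n where "inverse (real (Suc n)) < e" using reals_Archimedean by blast
    then show "(norm (a - p))\<^sup>2 \<le> d\<^sup>2 + e" using p[of n] by (simp add: S_def)
  qed
  then have "norm (a - p) \<le> d" using d0 by (rule power2_le_imp_le)
  moreover have "p \<in> A" using p[of 0] by (simp add: S_def)
  ultimately show thesis using that dle order_trans by blast
qed

text \<open>Justifies the definite description in \<open>nearest_point\<close>: a minimiser exists
  by completeness and is unique by convexity.\<close>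

lemma nearest_point_props:
  fixes A :: "'a::{real_inner, complete_space} set"
  assumes "closed A" "convex A" "A \<noteq> {}"
  shows "nearest_point A a \<in> A \<and> (\<forall>y\<in>A. norm (a - nearest_point A a) \<le> norm (a - y))"
  unfolding nearest_point_def
proof (rule theI')
  obtain p where "p \<in> A" "\<And>y. y \<in> A \<Longrightarrow> norm (a - p) \<le> norm (a - y)"
    using nearest_point_exists[OF assms] by blast
  then show "\<exists>!p. p \<in> A \<and> (\<forall>y\<in>A. norm (a - p) \<le> norm (a - y))"
    using any_closest_point_unique[OF assms(2,1), of p _ a] by (metis dist_norm)
qed

text \<open>The angle at the projection \<open>p\<close> between \<open>a - p\<close> and
  \<open>y - p\<close> is not acute, so the cross term in the expansion of the squared norm of
  \<open>(a - p) - (y - p)\<close> is non-negative.\<close>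

lemma nearest_point_pythagoras:
  fixes A :: "'a::{real_inner, complete_space} set"
  assumes "closed A" "convex A" "y \<in> A"
  shows "(norm (nearest_point A a - y))\<^sup>2 + (norm (nearest_point A a - a))\<^sup>2 \<le> (norm (a - y))\<^sup>2"
proof -
  define p where "p = nearest_point A a"
  have "p \<in> A" "\<forall>z\<in>A. dist a p \<le> dist a z"
    using nearest_point_props[of A a] assms by (auto simp: p_def dist_norm)
  then have "inner (a - p) (y - p) \<le> 0"
    using any_closest_point_dot assms by blast
  then show ?thesis
    unfolding p_def[symmetric]
    by (simp add: power2_norm_eq_inner inner_simps inner_commute algebra_simps)
qed

section \<open>Fejer monotone sequences\<close>

lemma fejer_infdist_decseq:
  fixes x :: "nat \<Rightarrow> 'a::metric_space"
  assumes "F \<noteq> {}" and "\<And>p t. p \<in> F \<Longrightarrow> dist (x (Suc t)) p \<le> dist (x t) p"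
  shows "decseq (\<lambda>t. infdist (x t) F)"
proof (rule decseq_SucI)
  fix t
  show "infdist (x (Suc t)) F \<le> infdist (x t) F"
    unfolding infdist_notempty[OF assms(1), of "x t"]
    using assms by (intro cINF_greatest) (auto intro: infdist_le2)
qed

text \<open>For each \<open>p\<close> in \<open>F\<close>, all iterates from time \<open>t\<close>
  on lie in the ball around \<open>p\<close> of radius \<open>dist (x t) p\<close>, so they are
  within twice that radius of \<open>x t\<close>. The infimum over \<open>p\<close> gives the Cauchy
  property, and the bound passes to the limit.\<close>

lemma fejer_convergence:
  fixes x :: "nat \<Rightarrow> 'a::complete_space"
  assumes "closed F" "F \<noteq> {}"
    and fejer: "\<And>p t. p \<in> F \<Longrightarrow> dist (x (Suc t)) p \<le> dist (x t) p"
    and lim: "(\<lambda>t. infdist (x t) F) \<longlonglongrightarrow> 0"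
  obtains l where "l \<in> F" "x \<longlonglongrightarrow> l" "\<And>t. dist (x t) l \<le> 2 * infdist (x t) F"
proof -
  have dist_le: "dist (x t) (x n) \<le> 2 * infdist (x t) F" if "t \<le> n" for t n
  proof -
    have "dist (x t) (x n) / 2 \<le> infdist (x t) F"
      unfolding infdist_notempty[OF assms(2), of "x t"]
    proof (rule cINF_greatest[OF assms(2)])
      fix p assume "p \<in> F"
      then have "decseq (\<lambda>t. dist (x t) p)" using fejer by (intro decseq_SucI)
      then have "dist (x n) p \<le> dist (x t) p" using that by (rule decseqD)
      then show "dist (x t) (x n) / 2 \<le> dist (x t) p"
        using dist_triangle2[of "x t" "x n" p] by simp
    qed
    then show ?thesis by simp
  qed
  have "Cauchy x"
  proof (rule metric_CauchyI)
    fix e :: real assume "e > 0"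
    then have "eventually (\<lambda>t. infdist (x t) F < e / 4) sequentially"
      using order_tendstoD(2)[OF lim, of "e / 4"] by simp
    then obtain N where N: "infdist (x N) F < e / 4" by (auto simp: eventually_sequentially)
    have "dist (x i) (x k) < e" if "i \<ge> N" "k \<ge> N" for i k
      using dist_le[OF that(1)] dist_le[OF that(2)] dist_triangle3[of "x i" "x k" "x N"] N by linarith
    then show "\<exists>N. \<forall>i\<ge>N. \<forall>k\<ge>N. dist (x i) (x k) < e" by blast
  qed
  then obtain l where l: "x \<longlonglongrightarrow> l" by (auto simp: Cauchy_convergent_iff convergent_def)
  have "(\<lambda>t. infdist (x t) F) \<longlonglongrightarrow> infdist l F" by (intro tendsto_infdist l)
  then have "infdist l F = 0" using lim LIMSEQ_unique by blast
  then have "l \<in> F" using assms(1,2) by (simp add: in_closed_iff_infdist_zero)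
  moreover have "dist (x t) l \<le> 2 * infdist (x t) F" for t
  proof (rule tendsto_upperbound)
    show "(\<lambda>n. dist (x t) (x n)) \<longlonglongrightarrow> dist (x t) l" by (intro tendsto_intros l)
    show "eventually (\<lambda>n. dist (x t) (x n) \<le> 2 * infdist (x t) F) sequentially"
      using dist_le eventually_sequentially by blast
  qed simp
  ultimately show thesis using that l by blast
qed

section \<open>Rates from a recurrence inequality\<close>

text \<open>Bernoulli's inequality for a negative exponent, from \<open>ln (1 - y) \<le> - y\<close>
  and \<open>1 + u \<le> exp u\<close>.\<close>

lemma bernoulli_powr_neg:
  fixes \<theta> y :: real
  assumes "0 \<le> y" "y < 1" "0 \<le> \<theta>"
  shows "1 + \<theta> * y \<le> (1 - y) powr (- \<theta>)"
proof -
  have "\<theta> * ln (1 - y) \<le> \<theta> * (- y)"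
    using ln_le_minus_one[of "1 - y"] assms by (intro mult_left_mono) auto
  then have "exp (\<theta> * y) \<le> (1 - y) powr (- \<theta>)"
    using assms by (simp add: powr_def)
  then show ?thesis using exp_ge_add_one_self[of "\<theta> * y"] by linarith
qed

text \<open>The quantity \<open>\<beta> k powr (- \<theta>)\<close> grows by at least \<open>\<theta> * c\<close> in each step.\<close>

lemma power_recurrence_rate:
  fixes \<beta> :: "nat \<Rightarrow> real"
  assumes "\<And>k. 0 \<le> \<beta> k" and rec: "\<And>k. \<beta> (Suc k) \<le> \<beta> k - c * \<beta> k powr (1 + \<theta>)"
    and "c > 0" "\<theta> > 0"
  obtains A where "A > 0" "\<And>k. \<beta> k \<le> A * real (Suc k) powr (- 1 / \<theta>)"
proof -
  \<comment> \<open>The two entries of the minimum serve the base case and the induction step. If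
    \<open>\<beta> 0 = 0\<close>, the convention \<open>0 powr _ = 0\<close> would make the minimum
    0, so any positive value is taken instead.\<close>
  define e where "e = (if \<beta> 0 = 0 then 1 else min (\<beta> 0 powr (- \<theta>)) (\<theta> * c))"
  have e: "e > 0" using assms by (auto simp: e_def)
  have dec: "\<beta> (Suc k) \<le> \<beta> k" for k
    using rec[of k] assms(3) by (smt (verit) mult_nonneg_nonneg powr_ge_zero)
  \<comment> \<open>A vanishing \<open>\<beta> k\<close> is split off because its negative power is
    0 by convention, not infinite.\<close>
  have *: "\<beta> k = 0 \<or> e * real (Suc k) \<le> \<beta> k powr (- \<theta>)" for k
  proof (induction k)
    case 0
    then show ?case by (simp add: e_def)
  next
    case (Suc k)
    show ?case
    proof (cases "\<beta> (Suc k) = 0")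
      case False
      then have pos: "\<beta> (Suc k) > 0" "\<beta> k > 0"
        using assms(1)[of "Suc k"] dec[of k] by auto
      \<comment> \<open>The guaranteed relative decrease in one step; it is below 1 because
        \<open>\<beta> (Suc k)\<close> is still positive.\<close>
      define y where "y = c * \<beta> k powr \<theta>"
      have rec': "\<beta> (Suc k) \<le> \<beta> k * (1 - y)"
        using rec[of k] pos by (simp add: y_def powr_add algebra_simps)
      have y: "0 \<le> y" "y < 1"
      proof -
        show "0 \<le> y" using assms(3) by (simp add: y_def)
        have "0 < \<beta> k * (1 - y)" using rec' pos by linarith
        then show "y < 1" using pos by (simp add: zero_less_mult_iff)
      qed
      have "\<beta> 0 \<noteq> 0"
      proof -
        have "decseq \<beta>" using dec by (rule decseq_SucI)
        then have "\<beta> (Suc k) \<le> \<beta> 0" by (rule decseqD) simp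
        then show ?thesis using pos by simp
      qed
      then have "e \<le> \<theta> * c" by (simp add: e_def)
      moreover have "e * real (Suc k) \<le> \<beta> k powr (- \<theta>)" using Suc pos by simp
      ultimately have "e * real (Suc (Suc k)) \<le> \<beta> k powr (- \<theta>) + \<theta> * c"
        by (simp add: algebra_simps)
      also have "\<dots> = \<beta> k powr (- \<theta>) * (1 + \<theta> * y)"
        using pos by (simp add: y_def powr_minus field_simps)
      also have "\<dots> \<le> \<beta> k powr (- \<theta>) * (1 - y) powr (- \<theta>)"
        using bernoulli_powr_neg[of y \<theta>] y assms(4) by (intro mult_left_mono) auto
      also have "\<dots> = (\<beta> k * (1 - y)) powr (- \<theta>)"
        using pos y by (simp add: powr_mult)
      also have "\<dots> \<le> \<beta> (Suc k) powr (- \<theta>)"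
        using rec' pos assms(4) by (intro powr_mono2') auto
      finally show ?thesis by simp
    qed simp
  qed
  show thesis
  proof (rule that[of "e powr (- 1 / \<theta>)"])
    show "e powr (- 1 / \<theta>) > 0" using e by simp
    show "\<beta> k \<le> e powr (- 1 / \<theta>) * real (Suc k) powr (- 1 / \<theta>)" for k
    proof (cases "\<beta> k = 0")
      case False
      then have pos: "\<beta> k > 0" using assms(1)[of k] by simp
      have "\<beta> k = (\<beta> k powr (- \<theta>)) powr (- 1 / \<theta>)"
        using pos assms(4) by (simp add: powr_powr)
      also have "\<dots> \<le> (e * real (Suc k)) powr (- 1 / \<theta>)"
        using *[of k] False e assms(4) by (intro powr_mono2') auto
      finally show ?thesis using e by (simp add: powr_mult)
    qed simp
  qed
qed

text \<open>With \<open>\<theta> = 1 / \<gamma> - 1\<close> the squares at block starts decay with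
  exponent \<open>1 / \<theta>\<close>, so \<open>d\<close> itself decays with half of it, which is
  \<open>\<gamma> / (2 * (1 - \<gamma>))\<close>. Monotonicity of \<open>d\<close> covers the times
  inside a block.\<close>

lemma block_polynomial_rate:
  fixes d :: "nat \<Rightarrow> real"
  assumes "decseq d" "\<And>t. 0 \<le> d t" "m > 0" "0 < \<gamma>" "\<gamma> < 1" "c > 0"
    and rec: "\<And>k. (d (m * Suc k))\<^sup>2 \<le> (d (m * k))\<^sup>2 - c * ((d (m * k))\<^sup>2) powr (1 / \<gamma>)"
  obtains M where "M > 0" "\<And>t. t \<ge> 1 \<Longrightarrow> d t \<le> M * real t powr (- (\<gamma> / (2 * (1 - \<gamma>))))"
proof -
  define \<theta> where "\<theta> = 1 / \<gamma> - 1"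
  define \<rho> where "\<rho> = \<gamma> / (2 * (1 - \<gamma>))"
  have \<theta>: "\<theta> > 0" "1 + \<theta> = 1 / \<gamma>" using assms(4,5) by (auto simp: \<theta>_def)
  have \<rho>: "\<rho> > 0" "1 / (\<theta> * 2) = \<rho>"
    using assms(4,5) by (auto simp: \<theta>_def \<rho>_def field_simps)
  obtain A where A: "A > 0" "\<And>k. (d (m * k))\<^sup>2 \<le> A * real (Suc k) powr (- 1 / \<theta>)"
    using power_recurrence_rate[of "\<lambda>k. (d (m * k))\<^sup>2" c \<theta>] rec assms(6) \<theta> by auto
  show thesis
  \<comment> \<open>The second factor converts blocks to steps: \<open>Suc (t div m)\<close> is at
    least \<open>t / m\<close>.\<close>
  proof (rule that[of "sqrt A * (1 / real m) powr (- \<rho>)"])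
    show "sqrt A * (1 / real m) powr (- \<rho>) > 0" using A assms(3) by simp
    fix t :: nat assume t: "t \<ge> 1"
    define k where "k = t div m"
    have "d t \<le> d (m * k)" using assms(1) by (rule decseqD) (simp add: k_def)
    also have "\<dots> \<le> sqrt (A * real (Suc k) powr (- 1 / \<theta>))"
      using A(2) by (rule real_le_rsqrt)
    also have "\<dots> = sqrt A * real (Suc k) powr (- \<rho>)"
      by (simp add: real_sqrt_mult powr_half_sqrt[symmetric] powr_powr \<rho>(2))
    also have "real (Suc k) powr (- \<rho>) \<le> (1 / real m * real t) powr (- \<rho>)"
    proof (rule powr_mono2')
      have "t \<le> m * Suc k"
        using dividend_less_times_div[of m t] assms(3) by (simp add: k_def)
      then have "real t \<le> real m * real (Suc k)" by (metis of_nat_le_iff of_nat_mult)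
      then show "1 / real m * real t \<le> real (Suc k)"
        using assms(3) by (simp add: field_simps)
    qed (use \<rho> t assms(3) in auto)
    finally show "d t \<le> sqrt A * (1 / real m) powr (- \<rho>) * real t powr (- (\<gamma> / (2 * (1 - \<gamma>))))"
      using A by (simp only: powr_mult \<rho>_def mult.assoc mult_left_mono real_sqrt_ge_zero)
  qed
qed

lemma block_linear_rate:
  fixes d :: "nat \<Rightarrow> real"
  assumes "decseq d" "\<And>t. 0 \<le> d t" "m > 0" "c > 0"
    and rec: "\<And>k. (d (m * Suc k))\<^sup>2 \<le> (d (m * k))\<^sup>2 - c * (d (m * k))\<^sup>2"
  obtains M r where "M > 0" "0 < r" "r < 1" "\<And>t. d t \<le> M * r ^ t"
proof -
  \<comment> \<open>The maximum keeps the contraction factor positive even if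
    \<open>c \<ge> 1\<close>, so that its root can be divided by.\<close>
  define q where "q = max (1 / 2) (1 - c)"
  have q: "0 < q" "q < 1" using assms(4) by (auto simp: q_def)
  \<comment> \<open>The root of order \<open>2 * m\<close>: the 2 undoes the square, and
    \<open>m\<close> spreads the gain of a block over its steps.\<close>
  define r where "r = q powr (1 / (2 * real m))"
  have r: "0 < r" "r < 1" using q assms(3) powr_less_mono2[of "1 / (2 * real m)" q 1] by (auto simp: r_def)
  have r2m: "(r ^ m)\<^sup>2 = q"
    using q assms(3) by (simp add: r_def powr_realpow[symmetric] powr_powr)
  have geo: "d (m * k) \<le> d 0 * (r ^ m) ^ k" for k
  proof (induction k)
    case (Suc k)
    have "(d (m * Suc k))\<^sup>2 \<le> (1 - c) * (d (m * k))\<^sup>2" using rec[of k] by (simp add: algebra_simps)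
    also have "\<dots> \<le> q * (d (m * k))\<^sup>2" by (intro mult_right_mono) (auto simp: q_def)
    also have "\<dots> = (r ^ m * d (m * k))\<^sup>2" by (simp add: r2m power_mult_distrib)
    finally have "d (m * Suc k) \<le> r ^ m * d (m * k)"
      by (rule power2_le_imp_le) (use r assms(2) in auto)
    also have "\<dots> \<le> r ^ m * (d 0 * (r ^ m) ^ k)" using Suc r by (intro mult_left_mono) auto
    finally show ?case by (simp add: algebra_simps)
  qed simp
  show thesis
  \<comment> \<open>Dividing by \<open>r ^ m\<close> pays for the steps since the last block start;
    the \<open>+ 1\<close> keeps the constant positive when \<open>d 0 = 0\<close>.\<close>
  proof (rule that[of "(d 0 + 1) / r ^ m" r])
    show "(d 0 + 1) / r ^ m > 0" using r assms(2)[of 0] by simp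
    fix t
    define k where "k = t div m"
    have "d t \<le> d (m * k)" using assms(1) by (rule decseqD) (simp add: k_def)
    also have "\<dots> \<le> (d 0 + 1) * (r ^ m) ^ k"
      using geo[of k] r by (smt (verit) mult_right_mono zero_le_power)
    also have "\<dots> = (d 0 + 1) / r ^ m * r ^ (m * Suc k)"
      using r by (simp add: power_add power_mult)
    also have "\<dots> \<le> (d 0 + 1) / r ^ m * r ^ t"
    proof (intro mult_left_mono power_decreasing)
      show "t \<le> m * Suc k"
        using dividend_less_times_div[of m t] assms(3) by (simp add: k_def)
    qed (use r assms(2)[of 0] in auto)
    finally show "d t \<le> (d 0 + 1) / r ^ m * r ^ t" .
  qed (use r in auto)
qed

text \<open>The sequence \<open>real t * r ^ t\<close> tends to 0 and is therefore bounded. This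
  turns a geometric rate into a sublinear one.\<close>

lemma geometric_le_inverse:
  fixes r :: real
  assumes "0 < r" "r < 1"
  obtains B where "\<And>t::nat. t \<ge> 1 \<Longrightarrow> r ^ t \<le> B * real t powr (- 1)"
proof -
  have "(\<lambda>t. real t * r ^ t) \<longlonglongrightarrow> 0"
    using powser_times_n_limit_0[of r] assms by simp
  then have "Bseq (\<lambda>t. real t * r ^ t)" by (intro convergent_imp_Bseq) (auto simp: convergent_def)
  then obtain B where B: "norm (real t * r ^ t) \<le> B" for t unfolding Bseq_def by blast
  show thesis
  proof (rule that[of B])
    fix t :: nat assume "t \<ge> 1"
    then show "r ^ t \<le> B * real t powr (- 1)"
      using B[of t] assms by (simp add: powr_minus_divide field_simps)
  qed
qed

section \<open>Cyclic projections\<close>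

text \<open>Triangle inequality along the path, then Cauchy-Schwarz, which costs the factor
  \<open>m\<close>. Summing over all \<open>m\<close> steps gives one bound for every
  \<open>k\<close> in the cycle.\<close>

lemma norm_telescope_sq:
  fixes x :: "nat \<Rightarrow> 'a::real_normed_vector"
  assumes "k \<le> m"
  shows "(norm (x (t + k) - x t))\<^sup>2 \<le> real m * (\<Sum>i<m. (norm (x (Suc (t + i)) - x (t + i)))\<^sup>2)"
proof -
  have "x (t + k) - x t = (\<Sum>i<k. x (Suc (t + i)) - x (t + i))"
    using sum_lessThan_telescope[of "\<lambda>i. x (t + i)" k] by simp
  then have "norm (x (t + k) - x t) \<le> (\<Sum>i<k. norm (x (Suc (t + i)) - x (t + i)))"
    by (metis norm_sum)
  also have "\<dots> \<le> (\<Sum>i<m. norm (x (Suc (t + i)) - x (t + i)))"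
    using assms by (intro sum_mono2) auto
  finally have "(norm (x (t + k) - x t))\<^sup>2 \<le> (\<Sum>i<m. norm (x (Suc (t + i)) - x (t + i)))\<^sup>2"
    by (intro power_mono) auto
  also have "\<dots> \<le> (\<Sum>i<m. (norm (x (Suc (t + i)) - x (t + i)))\<^sup>2) * real m"
    using sum_squared_le_sum_of_squares[of "\<lambda>i. norm (x (Suc (t + i)) - x (t + i))" "{..<m}"] by simp
  finally show ?thesis by (simp add: mult.commute)
qed

text \<open>Residue 0 is represented by \<open>m\<close>, since the indices start at 1.\<close>

lemma cyclic_index_exists:
  fixes m t :: nat
  assumes "m \<ge> 1"
  obtains j where "j \<in> {1..m}" "[j = t] (mod m)"
proof (cases "t mod m = 0")
  case True
  then show thesis using that[of m] assms by (simp add: cong_def)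
next
  case False
  then show thesis using that[of "t mod m"] assms by (simp add: cong_def)
qed

lemma cyclic_index_hits:
  fixes m t j :: nat
  assumes "m \<ge> 1"
  obtains k where "k < m" "[j = t + k] (mod m)"
proof -
  \<comment> \<open>The residue is formed in the integers because \<open>j - t\<close> may be
    negative.\<close>
  define k where "k = nat ((int j - int t) mod int m)"
  have k: "int k = (int j - int t) mod int m" using assms by (simp add: k_def)
  then have "int k < int m" using assms by simp
  moreover have "[int j = int (t + k)] (mod int m)"
    by (simp add: cong_def k mod_add_right_eq)
  ultimately show thesis using that[of k] by (simp add: cong_int_iff del: of_nat_add)
qed

text \<open>Regularity is left out of the locale: the lemmas that use it assume it on the orbit
  \<open>range x\<close> alone, so they apply both to an exponent found for the orbit and to a
  prescribed uniform one.\<close>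

locale cyclic_projections =
  fixes C :: "nat \<Rightarrow> 'a::{real_inner, complete_space} set"
    and m :: nat and x :: "nat \<Rightarrow> 'a"
  assumes m: "m \<ge> 1"
    and closed_C: "\<And>j. j \<in> {1..m} \<Longrightarrow> closed (C j)"
    and convex_C: "\<And>j. j \<in> {1..m} \<Longrightarrow> convex (C j)"
    and nonempty: "(\<Inter>j\<in>{1..m}. C j) \<noteq> {}"
    and step: "\<And>t j. j \<in> {1..m} \<Longrightarrow> [j = t] (mod m) \<Longrightarrow> x (Suc t) = nearest_point (C j) (x t)"
begin

abbreviation F where "F \<equiv> \<Inter>j\<in>{1..m}. C j"

lemma F_closed: "closed F"
  using closed_C by auto

lemma step_pythagoras:
  assumes "p \<in> F"
  shows "(norm (x (Suc t) - p))\<^sup>2 + (norm (x (Suc t) - x t))\<^sup>2 \<le> (norm (x t - p))\<^sup>2"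
proof -
  obtain j where j: "j \<in> {1..m}" "[j = t] (mod m)" using cyclic_index_exists[OF m] by blast
  show ?thesis
    unfolding step[OF j]
    using nearest_point_pythagoras[OF closed_C[OF j(1)] convex_C[OF j(1)], of p "x t"] assms j(1)
    by blast
qed

lemma fejer: "p \<in> F \<Longrightarrow> dist (x (Suc t)) p \<le> dist (x t) p"
  unfolding dist_norm
  by (rule power2_le_imp_le)
    (smt (verit) step_pythagoras[of p t] zero_le_power2, simp)

lemma decseq_infdist: "decseq (\<lambda>t. infdist (x t) F)"
  using nonempty fejer by (rule fejer_infdist_decseq)

text \<open>Regularity is given on bounded sets only; Fejer monotonicity towards a single point of
  \<open>F\<close> confines the orbit to a ball.\<close>

lemma bounded_range: "bounded (range x)"
proof -
  obtain p where p: "p \<in> F" using nonempty by blast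
  have "decseq (\<lambda>t. dist (x t) p)" using fejer[OF p] by (rule decseq_SucI)
  then have "dist (x t) p \<le> dist (x 0) p" for t by (rule decseqD) simp
  then show ?thesis unfolding bounded_def by (metis dist_commute rangeE)
qed

lemma cycle_pythagoras:
  assumes "p \<in> F"
  shows "(norm (x (t + n) - p))\<^sup>2 + (\<Sum>i<n. (norm (x (Suc (t + i)) - x (t + i)))\<^sup>2) \<le> (norm (x t - p))\<^sup>2"
proof (induction n)
  case (Suc n)
  then show ?case using step_pythagoras[OF assms, of "t + n"] by simp
qed simp

text \<open>The step lengths do not depend on \<open>p\<close>, so \<open>cycle_pythagoras\<close>
  survives the infimum over \<open>p\<close>. The square root comes first because
  \<open>infdist\<close> is an infimum of unsquared distances.\<close>

lemma cycle_infdist: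
  "(infdist (x (t + n)) F)\<^sup>2 + (\<Sum>i<n. (norm (x (Suc (t + i)) - x (t + i)))\<^sup>2) \<le> (infdist (x t) F)\<^sup>2"
  (is "?D + ?S \<le> _")
proof -
  have "sqrt (?D + ?S) \<le> infdist (x t) F"
    unfolding infdist_notempty[OF nonempty, of "x t"]
  proof (rule cINF_greatest[OF nonempty])
    fix p assume p: "p \<in> F"
    have "?D \<le> (norm (x (t + n) - p))\<^sup>2"
      using infdist_le[OF p, of "x (t + n)"] by (intro power_mono) (auto simp: dist_norm infdist_nonneg)
    then have "?D + ?S \<le> (norm (x t - p))\<^sup>2" using cycle_pythagoras[OF p, of t n] by linarith
    then show "sqrt (?D + ?S) \<le> dist (x t) p" by (simp add: dist_norm real_le_lsqrt sum_nonneg)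
  qed
  moreover have "?D + ?S \<ge> 0" by (simp add: sum_nonneg)
  ultimately show ?thesis by (simp add: sqrt_le_D)
qed

lemma max_infdist_le:
  "(MAX j\<in>{1..m}. infdist (x t) (C j)) \<le>
    sqrt (real m * (\<Sum>i<m. (norm (x (Suc (t + i)) - x (t + i)))\<^sup>2))"
proof (rule Max.boundedI)
  fix a assume "a \<in> (\<lambda>j. infdist (x t) (C j)) ` {1..m}"
  then obtain j where j: "j \<in> {1..m}" "a = infdist (x t) (C j)" by blast
  obtain k where k: "k < m" "[j = t + k] (mod m)" using cyclic_index_hits[OF m] by blast
  have "C j \<noteq> {}" using nonempty j by blast
  \<comment> \<open>Index \<open>j\<close> acts at time \<open>t + k\<close>, so its set is reached
    one step later; \<open>Suc k \<le> m\<close> stays within the telescoping bound.\<close>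
  then have "x (t + Suc k) \<in> C j"
    using step[OF j(1) k(2)] nearest_point_props[OF closed_C[OF j(1)] convex_C[OF j(1)]] by simp
  then have "a \<le> norm (x (t + Suc k) - x t)"
    using infdist_le[of "x (t + Suc k)" "C j" "x t"] j by (simp add: dist_norm norm_minus_commute)
  also have "\<dots> \<le> sqrt (real m * (\<Sum>i<m. (norm (x (Suc (t + i)) - x (t + i)))\<^sup>2))"
    using k by (intro real_le_rsqrt norm_telescope_sq) simp
  finally show "a \<le> sqrt (real m * (\<Sum>i<m. (norm (x (Suc (t + i)) - x (t + i)))\<^sup>2))" .
qed (use m in auto)

text \<open>Regularity bounds the squared distance to \<open>F\<close> by
  \<open>b\<^sup>2 * (m * S) powr \<gamma>\<close>. Solving for \<open>S\<close> gives the constant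
  \<open>c\<close> and a lower bound for the drop over a cycle.\<close>

lemma infdist_recurrence:
  assumes "hoelder_regular_on (range x) {1..m} C \<gamma>" "\<gamma> > 0"
  obtains c where "c > 0"
    "\<And>t. (infdist (x (t + m)) F)\<^sup>2 \<le> (infdist (x t) F)\<^sup>2 - c * ((infdist (x t) F)\<^sup>2) powr (1 / \<gamma>)"
proof -
  obtain b where b: "b > 0"
    "\<And>t. infdist (x t) F \<le> b * (MAX j\<in>{1..m}. infdist (x t) (C j)) powr \<gamma>"
    using assms(1) by (auto simp: hoelder_regular_on_def)
  define c where "c = (1 / b\<^sup>2) powr (1 / \<gamma>) / real m"
  show thesis
  proof (rule that[of c])
    show "c > 0" using b m by (simp add: c_def)
    fix t
    define S where "S = (\<Sum>i<m. (norm (x (Suc (t + i)) - x (t + i)))\<^sup>2)"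
    define d where "d = infdist (x t) F"
    have S: "S \<ge> 0" by (simp add: S_def sum_nonneg)
    have max0: "(MAX j\<in>{1..m}. infdist (x t) (C j)) \<ge> 0"
      using m by (subst Max_ge_iff) (auto simp: infdist_nonneg)
    have "d \<le> b * (MAX j\<in>{1..m}. infdist (x t) (C j)) powr \<gamma>" unfolding d_def by (rule b(2))
    also have "\<dots> \<le> b * sqrt (real m * S) powr \<gamma>"
      using b assms(2) max_infdist_le[of t] max0
      by (intro mult_left_mono powr_mono2) (auto simp: S_def)
    finally have "d\<^sup>2 \<le> (b * sqrt (real m * S) powr \<gamma>)\<^sup>2"
      by (intro power_mono) (auto simp: d_def infdist_nonneg)
    also have "\<dots> = b\<^sup>2 * (real m * S) powr \<gamma>"
      using S by (simp add: power_mult_distrib powr_half_sqrt[symmetric] powr_powr powr_add[symmetric] power2_eq_square)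
    finally have "(1 / b\<^sup>2 * d\<^sup>2) \<le> (real m * S) powr \<gamma>" using b(1) by (simp add: field_simps)
    then have "(1 / b\<^sup>2 * d\<^sup>2) powr (1 / \<gamma>) \<le> ((real m * S) powr \<gamma>) powr (1 / \<gamma>)"
      using assms(2) by (intro powr_mono2) auto
    also have "\<dots> = real m * S" using S assms(2) by (simp add: powr_powr)
    finally have "c * (d\<^sup>2) powr (1 / \<gamma>) \<le> S"
      unfolding powr_mult c_def using m by (simp add: pos_divide_le_eq mult.commute)
    then show "(infdist (x (t + m)) F)\<^sup>2 \<le> (infdist (x t) F)\<^sup>2 - c * ((infdist (x t) F)\<^sup>2) powr (1 / \<gamma>)"
      using cycle_infdist[of t m] unfolding S_def d_def by linarith
  qed
qed

section \<open>Decay rates of the distance to the intersection\<close>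

lemma infdist_polynomial_rate:
  assumes "hoelder_regular_on (range x) {1..m} C \<gamma>" "0 < \<gamma>" "\<gamma> < 1"
  obtains M where "M > 0" "\<And>t. t \<ge> 1 \<Longrightarrow> infdist (x t) F \<le> M * real t powr (- (\<gamma> / (2 * (1 - \<gamma>))))"
proof -
  obtain c where "c > 0" and c:
    "\<And>t. (infdist (x (t + m)) F)\<^sup>2 \<le> (infdist (x t) F)\<^sup>2 - c * ((infdist (x t) F)\<^sup>2) powr (1 / \<gamma>)"
    using infdist_recurrence[OF assms(1,2)] by blast
  have "(infdist (x (m * Suc k)) F)\<^sup>2 \<le>
      (infdist (x (m * k)) F)\<^sup>2 - c * ((infdist (x (m * k)) F)\<^sup>2) powr (1 / \<gamma>)" for k
    using c[of "m * k"] by (simp add: add.commute)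
  then show thesis
    using block_polynomial_rate[OF decseq_infdist infdist_nonneg _ assms(2,3) \<open>c > 0\<close>, of m] m that
    by auto
qed

lemma infdist_linear_rate:
  assumes "hoelder_regular_on (range x) {1..m} C 1"
  obtains M r where "M > 0" "0 < r" "r < 1" "\<And>t. infdist (x t) F \<le> M * r ^ t"
proof -
  obtain c where "c > 0" and c:
    "\<And>t. (infdist (x (t + m)) F)\<^sup>2 \<le> (infdist (x t) F)\<^sup>2 - c * ((infdist (x t) F)\<^sup>2) powr (1 / 1)"
    using infdist_recurrence[OF assms(1)] by auto
  have "(infdist (x (m * Suc k)) F)\<^sup>2 \<le>
      (infdist (x (m * k)) F)\<^sup>2 - c * (infdist (x (m * k)) F)\<^sup>2" for k
    using c[of "m * k"] by (simp add: add.commute)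
  then show thesis
    using block_linear_rate[OF decseq_infdist infdist_nonneg _ \<open>c > 0\<close>, of m] m that by auto
qed

text \<open>At \<open>\<gamma> = 1\<close> the polynomial exponent has denominator 0; there the
  geometric bound is weakened to rate 1/t.\<close>

lemma infdist_sublinear_rate:
  assumes "hoelder_regular_on (range x) {1..m} C \<gamma>" "0 < \<gamma>" "\<gamma> \<le> 1"
  obtains M \<rho> where "\<rho> > 0" "\<And>t. t \<ge> 1 \<Longrightarrow> infdist (x t) F \<le> M * real t powr (- \<rho>)"
proof (cases "\<gamma> < 1")
  case True
  then show thesis
    using infdist_polynomial_rate[OF assms(1,2) True] assms(2)
      that[of "\<gamma> / (2 * (1 - \<gamma>))"] by (metis diff_gt_0_iff_gt divide_pos_pos mult_pos_pos zero_less_numeral)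
next
  case False
  then have "\<gamma> = 1" using assms(3) by simp
  with assms(1) obtain M r where Mr: "M > 0" "0 < r" "r < 1" "\<And>t. infdist (x t) F \<le> M * r ^ t"
    using infdist_linear_rate by blast
  obtain B where B: "\<And>t::nat. t \<ge> 1 \<Longrightarrow> r ^ t \<le> B * real t powr (- 1)"
    using geometric_le_inverse[OF Mr(2,3)] by blast
  show thesis
  proof (rule that[of 1 "M * B"])
    fix t :: nat assume "t \<ge> 1"
    then have "M * r ^ t \<le> M * (B * real t powr (- 1))" using B Mr(1) by (intro mult_left_mono) auto
    then show "infdist (x t) F \<le> M * B * real t powr (- 1)"
      using Mr(4)[of t] by (simp only: mult.assoc)
  qed simp
qed

end

section \<open>Norm convergence and transfer of the rates to the iterates\<close>

theorem corollary3p10: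
  fixes C :: "nat \<Rightarrow> 'a::{real_inner, complete_space} set"
    and m :: nat
    and x :: "nat \<Rightarrow> 'a"
  assumes "m \<ge> 1"
    and "\<And>j. j \<in> {1..m} \<Longrightarrow> closed (C j)"
    and "\<And>j. j \<in> {1..m} \<Longrightarrow> convex (C j)"
    and "(\<Inter>j\<in>{1..m}. C j) \<noteq> {}"
    and "\<And>t j. j \<in> {1..m} \<Longrightarrow> [j = t] (mod m) \<Longrightarrow> x (Suc t) = nearest_point (C j) (x t)"
    and "bounded_hoelder_regular {1..m} C"
  shows "\<exists>xbar \<in> (\<Inter>j\<in>{1..m}. C j).
           x \<longlonglongrightarrow> xbar \<and>
           (\<exists>\<rho>>0. sublinear_rate x xbar \<rho>) \<and>
           (\<forall>\<gamma>. bounded_hoelder_regular_uniform {1..m} C \<gamma> \<longrightarrow>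
              (\<exists>M>0. \<exists>r\<in>{0..<1}. \<forall>t\<ge>1.
                 norm (x t - xbar) \<le>
                   (if \<gamma> < 1 then M * real t powr (- (\<gamma> / (2 * (1 - \<gamma>)))) else M * r ^ t)))"
proof -
  interpret cyclic_projections C m x
    by (rule cyclic_projections.intro) (fact assms)+
  \<comment> \<open>The exponent may vary with the bounded set, but a single set, the orbit, is
    enough.\<close>
  obtain \<gamma>\<^sub>0 where \<gamma>\<^sub>0: "hoelder_regular_on (range x) {1..m} C \<gamma>\<^sub>0" "0 < \<gamma>\<^sub>0" "\<gamma>\<^sub>0 \<le> 1"
    using assms(6) bounded_range unfolding bounded_hoelder_regular_def
    by (metis greaterThanAtMost_iff)
  then obtain M\<^sub>0 \<rho> where \<rho>: "\<rho> > 0"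
    and M\<^sub>0: "\<And>t. t \<ge> 1 \<Longrightarrow> infdist (x t) F \<le> M\<^sub>0 * real t powr (- \<rho>)"
    using infdist_sublinear_rate by blast
  have "(\<lambda>t. M\<^sub>0 * real t powr (- \<rho>)) \<longlonglongrightarrow> M\<^sub>0 * 0"
    using \<rho> by (intro tendsto_mult tendsto_const tendsto_neg_powr filterlim_real_sequentially) auto
  then have lim: "(\<lambda>t. M\<^sub>0 * real t powr (- \<rho>)) \<longlonglongrightarrow> 0" by simp
  have "(\<lambda>t. infdist (x t) F) \<longlonglongrightarrow> 0"
  proof (rule tendsto_sandwich[OF _ _ tendsto_const lim])
    show "\<forall>\<^sub>F t in sequentially. 0 \<le> infdist (x t) F"
      by (simp add: infdist_nonneg)
    show "\<forall>\<^sub>F t in sequentially. infdist (x t) F \<le> M\<^sub>0 * real t powr (- \<rho>)"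
      using M\<^sub>0 eventually_sequentially by blast
  qed
  \<comment> \<open>The limit is fixed before any uniform exponent is considered, so all rates
    concern the same point.\<close>
  then obtain l where l: "l \<in> F" "x \<longlonglongrightarrow> l" "\<And>t. dist (x t) l \<le> 2 * infdist (x t) F"
    using fejer_convergence[where x = x, OF F_closed nonempty fejer] by blast
  have le: "norm (x t - l) \<le> 2 * M * a" if "infdist (x t) F \<le> M * a" for t M a
    using l(3)[of t] that by (simp add: dist_norm)
  have "sublinear_rate x l \<rho>"
    unfolding sublinear_rate_def using le[OF M\<^sub>0] by blast
  moreover have "\<exists>M>0. \<exists>r\<in>{0..<1}. \<forall>t\<ge>1. norm (x t - l) \<le>
      (if \<gamma> < 1 then M * real t powr (- (\<gamma> / (2 * (1 - \<gamma>)))) else M * r ^ t)"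
    if "bounded_hoelder_regular_uniform {1..m} C \<gamma>" for \<gamma>
  proof -
    have reg: "hoelder_regular_on (range x) {1..m} C \<gamma>" and \<gamma>: "0 < \<gamma>" "\<gamma> \<le> 1"
      using that bounded_range by (auto simp: bounded_hoelder_regular_uniform_def)
    show ?thesis
    proof (cases "\<gamma> < 1")
      case True
      obtain M where M: "M > 0"
        "\<And>t. t \<ge> 1 \<Longrightarrow> infdist (x t) F \<le> M * real t powr (- (\<gamma> / (2 * (1 - \<gamma>))))"
        using infdist_polynomial_rate[OF reg \<gamma>(1) True] by blast
      \<comment> \<open>The 2 is the factor in the Fejer bound; \<open>r = 0\<close> is a dummy, as
        this branch does not mention \<open>r\<close>.\<close>
      show ?thesis
        using True M(1) le[OF M(2)] by (intro exI[of _ "2 * M"] conjI bexI[of _ 0]) auto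
    next
      case False
      with \<gamma> reg have "hoelder_regular_on (range x) {1..m} C 1" by (cases "\<gamma> = 1") auto
      then obtain M r where M: "M > 0" "0 < r" "r < 1" "\<And>t. infdist (x t) F \<le> M * r ^ t"
        using infdist_linear_rate by blast
      show ?thesis
        using False M(1-3) le[OF M(4)] by (intro exI[of _ "2 * M"] conjI bexI[of _ r]) auto
    qed
  qed
  ultimately show ?thesis using l \<rho> by blast
qed

end
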